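(* Let $k,N\ge2$ be positive integers and let $A_1,\dots,A_k$ be positive definite symmetric $N\times N$ matrices with constant coefficients. There exists an exponent $\bar\nu\in(0,2)$, depending on $N$ and on $A_1,\dots,A_k$, such that the following holds. For $i=1,\dots,k$, let $u_i\in H^1_{\mathrm{loc}}(\mathbb{R}^N)\cap C(\mathbb{R}^N)$ be nonnegative functions such that $$u_i\cdot u_j\equiv0\ \text{ in }\mathbb{R}^N\text{ if }i\ne j,\qquad\text{and}\qquad -\mathrm{div}(A_i\nabla u_i)\le0\ \text{ in }\mathbb{R}^N.$$ Suppose that for every $i=1,\dots,k$ the function $u_i$ grows at most like $|x|^{\alpha_i}$, namely $$|u_i(x)|\le C(1+|x|^{\alpha_i})\qquad\text{for every }x\in\mathbb{R}^N,\text{ for some }C>0,$$ with $\alpha_i>0$ for every $i$, and $\alpha_i+\alpha_j<\bar\nu$ for every $i\ne j$. Then $k-1$ of the functions $u_i$ are identically $0$.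
   Context: Differential inequalities are understood in the weak sense. *)

theory Defs
  imports "HOL-Analysis.Analysis"
begin

definition partial_deriv :: "'n \<Rightarrow> (real^'n \<Rightarrow> real) \<Rightarrow> real^'n \<Rightarrow> real" where
  "partial_deriv i f x = frechet_derivative f (at x) (axis i 1)"

definition gradient :: "(real^'n \<Rightarrow> real) \<Rightarrow> real^'n \<Rightarrow> real^'n" where
  "gradient f x = (\<chi> i. partial_deriv i f x)"

primrec C_k :: "nat \<Rightarrow> (real^'n \<Rightarrow> real) \<Rightarrow> bool" where
  "C_k 0 f \<longleftrightarrow> continuous_on UNIV f"
| "C_k (Suc m) f \<longleftrightarrow> (\<forall>x. f differentiable (at x)) \<and> (\<forall>i. C_k m (partial_deriv i f))"

definition test_function :: "(real^'n \<Rightarrow> real) \<Rightarrow> bool" where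
  "test_function \<phi> \<longleftrightarrow> (\<forall>m. C_k m \<phi>) \<and> compact (closure {x. \<phi> x \<noteq> 0})"

definition L1_loc :: "(real^'n \<Rightarrow> 'b::euclidean_space) \<Rightarrow> bool" where
  "L1_loc f \<longleftrightarrow> (\<forall>K. compact K \<longrightarrow> set_integrable lebesgue K f)"

definition L2_loc :: "(real^'n \<Rightarrow> 'b::euclidean_space) \<Rightarrow> bool" where
  "L2_loc f \<longleftrightarrow> f \<in> borel_measurable lebesgue \<and>
     (\<forall>K. compact K \<longrightarrow> set_integrable lebesgue K (\<lambda>x. (norm (f x))\<^sup>2))"

definition has_weak_gradient :: "(real^'n \<Rightarrow> real) \<Rightarrow> (real^'n \<Rightarrow> real^'n) \<Rightarrow> bool" where
  "has_weak_gradient u g \<longleftrightarrow> L1_loc u \<and> L1_loc g \<and>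
     (\<forall>\<phi> i. test_function \<phi> \<longrightarrow>
        (LINT x|lebesgue. u x * partial_deriv i \<phi> x) = - (LINT x|lebesgue. g x $ i * \<phi> x))"

definition H1_loc :: "(real^'n \<Rightarrow> real) \<Rightarrow> bool" where
  "H1_loc u \<longleftrightarrow> L2_loc u \<and> (\<exists>g. has_weak_gradient u g \<and> L2_loc g)"

(* - div (A grad u) \<le> 0 in the weak sense.  The weak gradient is unique up to null sets,
   so the choice of the representative g is immaterial. *)
definition weak_subsolution :: "real^'n^'n \<Rightarrow> (real^'n \<Rightarrow> real) \<Rightarrow> bool" where
  "weak_subsolution A u \<longleftrightarrow> (\<exists>g. has_weak_gradient u g \<and>
     (\<forall>\<phi>. test_function \<phi> \<and> (\<forall>x. 0 \<le> \<phi> x) \<longrightarrow>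
        (LINT x|lebesgue. (A *v g x) \<bullet> gradient \<phi> x) \<le> 0))"

definition positive_definite :: "real^'n^'n \<Rightarrow> bool" where
  "positive_definite A \<longleftrightarrow> (\<forall>x. x \<noteq> 0 \<longrightarrow> 0 < x \<bullet> (A *v x))"

end

theory Submission imports Defs begin

text \<open>
The exponent comes from a mean value inequality combined with a count of measures: two nonnegative
functions with product zero cannot both be positive on more than half of a ball.

Let \<open>q z = z \<bullet> A\<inverse> z\<close>. A continuous weak subsolution \<open>u\<close> of \<open>div (A grad u) \<ge> 0\<close> lies at each point below its
averages against the kernels \<open>r ^ N f (q (r (y - x)))\<close>, for a smooth \<open>f\<close> supported in \<open>{..1}\<close>
(\<open>sub_mean_value\<close>). Indeed, the \<open>r\<close>-derivative of such a kernel is a negative multiple of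
\<open>div (A grad \<psi>)\<close> with a nonnegative test function \<open>\<psi>\<close>, so that the average decreases in \<open>r\<close>, and for
\<open>r \<rightarrow> \<infinity>\<close> it tends to a constant multiple of \<open>u x\<close>.

If \<open>u \<ge> 0\<close> vanishes on at least half of the ball of radius \<open>R\<close>, then a fixed fraction of the kernel mass
is wasted on the zero set, whence the supremum of \<open>u\<close> over this ball is at most \<open>1 - \<delta>\<close> times the supremum
over the ball of radius \<open>L R\<close>, with \<open>\<delta>\<close> and \<open>L\<close> depending only on the dimension and on \<open>A\<close>
(\<open>exists_decay\<close>).

Now let \<open>u\<close> and \<open>v\<close> be subsolutions for two matrices with \<open>u v = 0\<close>. In every ball one of them vanishes on
at least half of the volume, so the product of their suprema gains the factor \<open>1 - \<delta>\<close> from each scale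
\<open>L R\<close> to the next smaller scale \<open>R\<close> (\<open>product_decay\<close>). If the product grows more slowly than
\<open>|x| powr \<nu>\<close> with \<open>L powr \<nu> \<le> 1 / (1 - \<delta>)\<close>, iteration from infinity forces it to vanish: \<open>u\<close> or
\<open>v\<close> is identically zero (\<open>slow_growth_imp_zero\<close>). Applied to all pairs, with \<open>\<delta>\<close> and \<open>L\<close> common to the
finitely many matrices, this leaves at most one nonzero function.
\<close>

section \<open>A smooth bump and the test functions built from it\<close>

text \<open>For every \<open>n\<close> the function \<open>bump n\<close> is smooth and vanishes on \<open>{1..}\<close>. The powers of \<open>1 - s\<close> in the
denominator make the family closed under differentiation: the derivative of \<open>bump n\<close> is
\<open>n bump (n + 1) - bump (n + 2)\<close>; in particular \<open>bump 2\<close> is minus the derivative of \<open>bump 0\<close>.\<close>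

definition bump :: "nat \<Rightarrow> real \<Rightarrow> real" where
  "bump n s = (if s < 1 then exp (- 1 / (1 - s)) / (1 - s) ^ n else 0)"

lemma bump_nonneg: "0 \<le> bump n s"
  by (simp add: bump_def)

lemma bump_eq_0: "1 \<le> s \<Longrightarrow> bump n s = 0"
  by (simp add: bump_def)

lemma bump_tendsto_0: "(bump n \<longlongrightarrow> 0) (at 1)"
proof -
  have "filterlim (\<lambda>s::real. 1 - s) (at_right 0) (at_left 1)"
    unfolding filterlim_at
    by (auto intro!: tendsto_eq_intros simp: eventually_at_left_field intro!: exI[of _ 0])
  then have "filterlim (\<lambda>s::real. inverse (1 - s)) at_top (at_left 1)"
    by (rule filterlim_compose[OF filterlim_inverse_at_top_right])
  then have "((\<lambda>s::real. inverse (1 - s) ^ n / exp (inverse (1 - s))) \<longlongrightarrow> 0) (at_left 1)"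
    by (rule filterlim_compose[OF tendsto_power_div_exp_0])
  moreover have "\<forall>\<^sub>F s in at_left 1. inverse (1 - s) ^ n / exp (inverse (1 - s)) = bump n s"
    by (auto simp: eventually_at_left_field bump_def exp_minus field_simps intro!: exI[of _ 0])
  ultimately have "(bump n \<longlongrightarrow> 0) (at_left 1)"
    by (rule Lim_transform_eventually)
  moreover have "(bump n \<longlongrightarrow> 0) (at_right 1)"
    by (rule tendsto_eventually) (auto simp: eventually_at_right_field bump_def intro!: exI[of _ 2])
  ultimately show ?thesis
    by (simp add: filterlim_split_at)
qed

lemma bump_has_derivative:
  "(bump n has_real_derivative real n * bump (Suc n) s - bump (Suc (Suc n)) s) (at s)"
proof -
  consider "s < 1" | "s = 1" | "s > 1" by linarith
  then show ?thesis
  proof cases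
    case 1
    let ?w = "\<lambda>s::real. inverse (1 - s)"
    have "(?w has_real_derivative ?w s ^ 2) (at s)"
      using 1 by (auto intro!: derivative_eq_intros simp: power2_eq_square)
    moreover have "((\<lambda>w::real. exp (- w) * w ^ n) has_real_derivative
        exp (- w) * (real n * w ^ (n - 1)) - exp (- w) * w ^ n) (at w)" for w
      by (auto intro!: derivative_eq_intros)
    ultimately have "((\<lambda>s. exp (- ?w s) * ?w s ^ n) has_real_derivative
        (exp (- ?w s) * (real n * ?w s ^ (n - 1)) - exp (- ?w s) * ?w s ^ n) * ?w s ^ 2) (at s)"
      by (rule DERIV_chain2[rotated])
    also have "(exp (- ?w s) * (real n * ?w s ^ (n - 1)) - exp (- ?w s) * ?w s ^ n) * ?w s ^ 2
        = real n * (exp (- ?w s) * ?w s ^ Suc n) - exp (- ?w s) * ?w s ^ Suc (Suc n)"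
      by (cases n) (simp_all add: algebra_simps power2_eq_square)
    also have "\<dots> = real n * bump (Suc n) s - bump (Suc (Suc n)) s"
      using 1 by (simp add: bump_def divide_inverse power_inverse)
    finally have "((\<lambda>s. exp (- ?w s) * ?w s ^ n) has_real_derivative
        real n * bump (Suc n) s - bump (Suc (Suc n)) s) (at s)" .
    then show ?thesis
      by (rule has_field_derivative_transform_within_open[where S = "{..<1}"]) (use 1 in \<open>auto simp: bump_def divide_inverse power_inverse\<close>)
  next
    case 2
    have "(\<lambda>s. - bump (Suc n) s) \<midarrow>1\<rightarrow> 0"
      using tendsto_minus[OF bump_tendsto_0[of "Suc n"]] by simp
    \<comment> \<open>since \<open>bump n 1 = 0\<close>, the difference quotient at \<open>1\<close> is minus the bump of the next index\<close>
    moreover have "(bump n t - bump n 1) / (t - 1) = - bump (Suc n) t" if "t \<noteq> 1" for t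
      using that by (auto simp: bump_def field_simps)
    ultimately have "(\<lambda>t. (bump n t - bump n 1) / (t - 1)) \<midarrow>1\<rightarrow> 0"
      by (subst LIM_equal) auto
    with 2 show ?thesis
      by (simp add: has_field_derivative_iff bump_eq_0)
  next
    case 3
    have "((\<lambda>s. 0) has_real_derivative 0) (at s)" by simp
    then have "(bump n has_real_derivative 0) (at s)"
      by (rule has_field_derivative_transform_within_open[where S = "{1<..}"]) (use 3 in \<open>auto simp: bump_def\<close>)
    with 3 show ?thesis by (simp add: bump_eq_0)
  qed
qed

lemma continuous_bump: "continuous_on S f \<Longrightarrow> continuous_on S (\<lambda>x. bump n (f x))"
  by (rule continuous_on_compose2[of UNIV])
    (auto intro!: continuous_at_imp_continuous_on DERIV_isCont[OF bump_has_derivative])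

text \<open>Smoothness is proved for a whole class of functions at once: the class generated from constants
and coordinates by sums, products and composition with the bumps consists of differentiable functions
and is closed under partial derivatives, so each of its members is \<open>C_k\<close> for every order. Polynomials, and
bumps of polynomials, belong to it.\<close>

inductive bump_poly :: "(real^'n \<Rightarrow> real) \<Rightarrow> bool" where
  const: "bump_poly (\<lambda>y. c)"
| coord: "bump_poly (\<lambda>y. y $ i)"
| add: "bump_poly f \<Longrightarrow> bump_poly g \<Longrightarrow> bump_poly (\<lambda>y. f y + g y)"
| mult: "bump_poly f \<Longrightarrow> bump_poly g \<Longrightarrow> bump_poly (\<lambda>y. f y * g y)"
| comp: "bump_poly f \<Longrightarrow> bump_poly (\<lambda>y. bump n (f y))"

lemma partial_deriv_eq:
  "(f has_derivative f') (at x) \<Longrightarrow> partial_deriv i f x = f' (axis i 1)"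
  unfolding partial_deriv_def by (metis frechet_derivative_at)

lemma bump_poly_deriv:
  fixes f :: "real^'n \<Rightarrow> real"
  shows "bump_poly f \<Longrightarrow> (\<forall>x. f differentiable at x) \<and> bump_poly (partial_deriv i f)"
proof (induction rule: bump_poly.induct)
  case (const c)
  have "partial_deriv i (\<lambda>y::real^'n. c) = (\<lambda>y. 0)"
    by (rule ext, subst partial_deriv_eq[OF has_derivative_const]) simp
  then show ?case by (simp add: bump_poly.const)
next
  case (coord j)
  have d: "((\<lambda>y::real^'n. y $ j) has_derivative (\<lambda>h. h $ j)) (at x)" for x
    by (rule bounded_linear_imp_has_derivative) (rule bounded_linear_vec_nth)
  have "partial_deriv i (\<lambda>y::real^'n. y $ j) = (\<lambda>y. axis i 1 $ j)"
    by (rule ext, subst partial_deriv_eq[OF d]) simp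
  then show ?case using d by (auto simp add: bump_poly.const differentiable_def)
next
  case (add f g)
  have d: "((\<lambda>y. f y + g y) has_derivative
     (\<lambda>h. frechet_derivative f (at x) h + frechet_derivative g (at x) h)) (at x)" for x
    using add by (auto intro!: has_derivative_add simp: frechet_derivative_works)
  have "partial_deriv i (\<lambda>y. f y + g y) = (\<lambda>y. partial_deriv i f y + partial_deriv i g y)"
    by (rule ext, subst partial_deriv_eq[OF d]) (simp add: partial_deriv_def)
  then show ?case using add d by (auto intro: bump_poly.add simp: differentiable_def)
next
  case (mult f g)
  have d: "((\<lambda>y. f y * g y) has_derivative
     (\<lambda>h. f x * frechet_derivative g (at x) h + frechet_derivative f (at x) h * g x)) (at x)" for x
    using mult by (auto intro!: has_derivative_mult simp: frechet_derivative_works)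
  have "partial_deriv i (\<lambda>y. f y * g y) = (\<lambda>y. f y * partial_deriv i g y + partial_deriv i f y * g y)"
    by (rule ext, subst partial_deriv_eq[OF d]) (simp add: partial_deriv_def)
  then show ?case using mult d by (auto intro: bump_poly.intros simp: differentiable_def)
next
  case (comp f n)
  have d: "((\<lambda>y. bump n (f y)) has_derivative
     (\<lambda>h. (real n * bump (Suc n) (f x) - bump (Suc (Suc n)) (f x)) * frechet_derivative f (at x) h)) (at x)" for x
    using comp 
    by (intro has_derivative_compose[OF _ bump_has_derivative[unfolded has_field_derivative_def]])
       (auto simp: frechet_derivative_works)
  have "partial_deriv i (\<lambda>y. bump n (f y)) =
     (\<lambda>y. (real n * bump (Suc n) (f y) + (-1) * bump (Suc (Suc n)) (f y)) * partial_deriv i f y)"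
    by (rule ext, subst partial_deriv_eq[OF d]) (simp add: partial_deriv_def)
  moreover have "bump_poly (\<lambda>y. (real n * bump (Suc n) (f y) + (-1) * bump (Suc (Suc n)) (f y)) * partial_deriv i f y)"
    using comp by (intro bump_poly.intros) auto
  ultimately show ?case using d by (auto simp: differentiable_def)
qed

lemma bump_poly_continuous: "bump_poly f \<Longrightarrow> continuous_on S f"
  using bump_poly_deriv[of f]
  by (auto intro!: continuous_at_imp_continuous_on differentiable_imp_continuous_within)

lemma bump_poly_C_k: "bump_poly f \<Longrightarrow> C_k m f"
  by (induction m arbitrary: f) (auto simp: bump_poly_continuous bump_poly_deriv)

lemma bump_poly_sum:
  "(\<And>i. i \<in> I \<Longrightarrow> bump_poly (f i)) \<Longrightarrow> bump_poly (\<lambda>y. \<Sum>i\<in>I. f i y)"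
  by (induction I rule: infinite_finite_induct) (auto intro: bump_poly.intros)

lemma test_function_bump_poly:
  assumes "bump_poly f" "bounded {y. f y \<noteq> 0}"
  shows "test_function f"
  using assms by (auto simp: test_function_def bump_poly_C_k)

section \<open>Integrability of products with compactly supported functions\<close>

lemma integral_continuous_bounded_support:
  fixes f :: "'a::euclidean_space \<Rightarrow> real"
  assumes "continuous_on UNIV f" "\<And>y. f y \<noteq> 0 \<Longrightarrow> y \<in> cbox a b"
  shows "integrable lebesgue f" and "(LINT y|lebesgue. f y) = integral (cbox a b) f"
proof -
  have "integrable lborel (\<lambda>y. indicator (cbox a b) y *\<^sub>R f y)"
    by (rule borel_integrable_compact) (auto intro: continuous_on_subset[OF assms(1)])
  moreover have eq: "(\<lambda>y. indicator (cbox a b) y *\<^sub>R f y) = f"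
    using assms(2) by (auto simp: indicator_def fun_eq_iff)
  ultimately have int: "integrable lborel f" by simp
  then show "integrable lebesgue f" by (rule integrable_completion[THEN iffD2, rotated]) (use int in auto)
  have "(LINT y|lebesgue. f y) = (LINT y|lborel. f y)"
    using int by (intro integral_completion) auto
  also have "\<dots> = integral (cbox a b) f"
    using set_borel_integral_eq_integral(2)[of "cbox a b" f, unfolded set_integrable_def set_lebesgue_integral_def eq] int
    by simp
  finally show "(LINT y|lebesgue. f y) = integral (cbox a b) f" .
qed

lemma integrable_L1_loc_mult:
  fixes g :: "real^'n \<Rightarrow> real^'n"
  assumes "L1_loc g" "continuous_on UNIV \<phi>" "bounded {y. \<phi> y \<noteq> 0}"
  shows "integrable lebesgue (\<lambda>y. g y $ i * \<phi> y)"
proof -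
  let ?K = "closure {y. \<phi> y \<noteq> 0}"
  have K: "compact ?K" using assms(3) by auto
  then have g: "integrable lebesgue (\<lambda>y. indicator ?K y *\<^sub>R g y)"
    using assms(1) by (simp add: L1_loc_def set_integrable_def)
  have "compact (\<phi> ` ?K)"
    by (intro compact_continuous_image K continuous_on_subset[OF assms(2)]) auto
  then obtain b where b: "\<And>y. y \<in> ?K \<Longrightarrow> \<bar>\<phi> y\<bar> \<le> b"
    using compact_imp_bounded[of "\<phi> ` ?K"] by (auto simp: bounded_iff)
  have meas: "(\<lambda>y. g y $ i * \<phi> y) \<in> borel_measurable lebesgue"
  proof -
    have "(\<lambda>y. (indicator ?K y *\<^sub>R g y) \<bullet> axis i 1 * \<phi> y) \<in> borel_measurable lebesgue"
      using borel_measurable_integrable[OF g] borel_measurable_continuous_onI[OF assms(2)]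
      by (intro borel_measurable_times borel_measurable_inner) (auto intro: measurable_completion)
    moreover have "(indicator ?K y *\<^sub>R g y) \<bullet> axis i 1 * \<phi> y = g y $ i * \<phi> y" for y
      using closure_subset[of "{y. \<phi> y \<noteq> 0}"] by (auto simp: indicator_def inner_axis)
    ultimately show ?thesis by (simp only:)
  qed
  show ?thesis
  proof (rule Bochner_Integration.integrable_bound[OF integrable_mult_right[of "b", OF integrable_norm[OF g]] meas])
    show "AE y in lebesgue. norm (g y $ i * \<phi> y) \<le> norm (b * norm (indicator ?K y *\<^sub>R g y))"
    proof (intro always_eventually allI)
      fix y
      show "norm (g y $ i * \<phi> y) \<le> norm (b * norm (indicator ?K y *\<^sub>R g y))"
      proof (cases "\<phi> y = 0")
        case False
        then have "y \<in> ?K" using closure_subset[of "{y. \<phi> y \<noteq> 0}"] by auto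
        then have "\<bar>g y $ i\<bar> * \<bar>\<phi> y\<bar> \<le> norm (g y) * \<bar>b\<bar>"
          using b[of y] component_le_norm_cart[of "g y" i] by (intro mult_mono) auto
        then show ?thesis using \<open>y \<in> ?K\<close> by (simp add: abs_mult mult.commute)
      qed simp
    qed
  qed
qed

section \<open>The kernel of an elliptic operator with constant coefficients\<close>

locale elliptic_matrix =
  fixes A :: "real^'n^'n"
  assumes symmetric: "transpose A = A" and posdef: "positive_definite A"
begin

text \<open>The level sets of the quadratic form \<open>q\<close> of the inverse matrix are the ellipsoids that play for
\<open>div (A grad u)\<close> the role that balls play for the Laplacian: for a function \<open>f (q z)\<close> the flux
\<open>A grad f (q z) = 2 f' (q z) z\<close> is radial.\<close>

definition A_inv where "A_inv = matrix_inv A"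

definition q :: "real^'n \<Rightarrow> real" where "q z = z \<bullet> (A_inv *v z)"

abbreviation kernel :: "real \<Rightarrow> real^'n \<Rightarrow> real^'n \<Rightarrow> real" where
  "kernel r x y \<equiv> bump 2 (q (r *\<^sub>R (y - x)))"

lemma self_adjoint: "(A *v x) \<bullet> y = x \<bullet> (A *v y)"
  by (metis dot_lmul_matrix symmetric transpose_matrix_vector)

lemma A_mult_A_inv: "A *v (A_inv *v x) = x"
proof -
  have "A *v z \<noteq> 0" if "z \<noteq> 0" for z
    using posdef that by (force simp: positive_definite_def)
  then have "\<exists>C. C ** A = mat 1"
    by (subst matrix_left_invertible_ker) auto
  then have "invertible A" by (simp add: invertible_left_inverse)
  then have "A ** A_inv = mat 1"
    unfolding A_inv_def matrix_inv_def invertible_def by (rule someI2_ex) simp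
  then show ?thesis by (simp add: matrix_vector_mul_assoc)
qed

lemma A_inv_self_adjoint: "(A_inv *v x) \<bullet> y = x \<bullet> (A_inv *v y)"
  by (metis A_mult_A_inv self_adjoint)

lemma q_pos: "z \<noteq> 0 \<Longrightarrow> 0 < q z"
  using posdef A_mult_A_inv[of z] unfolding q_def positive_definite_def
  by (metis inner_commute matrix_vector_mult_0_right)

lemma q_scaleR: "q (r *\<^sub>R z) = r\<^sup>2 * q z"
  by (simp add: q_def matrix_vector_mult_scaleR power2_eq_square)

lemma continuous_on_q [continuous_intros]: "continuous_on S f \<Longrightarrow> continuous_on S (\<lambda>y. q (f y))"
  unfolding q_def
  by (intro continuous_intros bounded_linear.continuous_on[OF matrix_vector_mul_bounded_linear])

lemma q_lower: obtains \<rho> where "0 < \<rho>" "\<And>z. q z < 1 \<Longrightarrow> norm z \<le> \<rho>"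
proof -
  have "\<exists>x\<in>sphere 0 1. \<forall>y\<in>sphere 0 1. q x \<le> q y"
    by (intro continuous_attains_inf continuous_intros) auto
  then obtain e :: "real^'n" where e: "norm e = 1" "\<And>y. norm y = 1 \<Longrightarrow> q e \<le> q y" by auto
  then have e0: "0 < q e" by (intro q_pos) auto
  show thesis
  proof (rule that[of "1 / sqrt (q e)"])
    fix z assume z: "q z < 1"
    show "norm z \<le> 1 / sqrt (q e)"
    proof (cases "z = 0")
      case False
      have "q e \<le> q ((1 / norm z) *\<^sub>R z)" using False by (intro e) auto
      then have "q e * (norm z)\<^sup>2 \<le> q z" using False by (simp add: q_scaleR field_simps)
      then have "(norm z)\<^sup>2 \<le> 1 / q e" using z e0 by (simp add: field_simps)
      then have "norm z \<le> sqrt (1 / q e)" by (rule real_le_rsqrt)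
      then show ?thesis by (simp add: real_sqrt_divide)
    qed (use e0 in auto)
  qed (use e0 in auto)
qed

text \<open>At scale \<open>1 / r\<close> the bumps live in a ball of radius comparable to \<open>1 / r\<close>, by the positive lower bound
of \<open>q\<close> on the unit sphere.\<close>

lemma bump_support:
  obtains \<rho> where "0 < \<rho>"
    "\<And>n r x y. 0 < r \<Longrightarrow> bump n (q (r *\<^sub>R (y - x))) \<noteq> 0 \<Longrightarrow> y \<in> cball x (\<rho> / r)"
proof -
  obtain \<rho> where \<rho>: "0 < \<rho>" "\<And>z. q z < 1 \<Longrightarrow> norm z \<le> \<rho>" using q_lower by blast
  have "y \<in> cball x (\<rho> / r)" if r: "0 < r" and "bump n (q (r *\<^sub>R (y - x))) \<noteq> 0" for n r x y
  proof -
    have "q (r *\<^sub>R (y - x)) < 1" using that bump_eq_0 by (meson not_less)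
    then have "norm (r *\<^sub>R (y - x)) \<le> \<rho>" by (rule \<rho>)
    then show ?thesis using r
      by (simp add: dist_norm norm_minus_commute pos_le_divide_eq mult.commute del: scaleR_right_diff_distrib)
  qed
  with \<rho>(1) that show thesis by blast
qed

lemma bump_poly_q: "bump_poly (\<lambda>y. q (r *\<^sub>R (y - x)))"
proof -
  have "bump_poly (\<lambda>y. \<Sum>i\<in>UNIV. (r * (y $ i + - x $ i)) * (\<Sum>j\<in>UNIV. A_inv $ i $ j * (r * (y $ j + - x $ j))))"
    by (intro bump_poly_sum bump_poly.intros)
  then show ?thesis by (simp add: q_def inner_vec_def matrix_vector_mult_def)
qed

lemma q_has_derivative:
  "((\<lambda>y. q (r *\<^sub>R (y - x))) has_derivative (\<lambda>h. 2 * r\<^sup>2 * (h \<bullet> (A_inv *v (y - x))))) (at y)"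
proof -
  have lin: "((\<lambda>y. r *\<^sub>R (y - x)) has_derivative (\<lambda>h. r *\<^sub>R h)) (at y)"
    by (auto intro!: derivative_eq_intros)
  have "((\<lambda>y. q (r *\<^sub>R (y - x))) has_derivative
      (\<lambda>h. (r *\<^sub>R (y - x)) \<bullet> (A_inv *v (r *\<^sub>R h)) + (r *\<^sub>R h) \<bullet> (A_inv *v (r *\<^sub>R (y - x))))) (at y)"
    unfolding q_def
    by (intro has_derivative_inner lin bounded_linear.has_derivative[OF matrix_vector_mul_bounded_linear])
  also have "(\<lambda>h. (r *\<^sub>R (y - x)) \<bullet> (A_inv *v (r *\<^sub>R h)) + (r *\<^sub>R h) \<bullet> (A_inv *v (r *\<^sub>R (y - x))))
      = (\<lambda>h. 2 * r\<^sup>2 * (h \<bullet> (A_inv *v (y - x))))"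
  proof
    fix h
    have "(y - x) \<bullet> (A_inv *v h) = h \<bullet> (A_inv *v (y - x))"
      by (metis A_inv_self_adjoint inner_commute)
    then show "(r *\<^sub>R (y - x)) \<bullet> (A_inv *v (r *\<^sub>R h)) + (r *\<^sub>R h) \<bullet> (A_inv *v (r *\<^sub>R (y - x)))
        = 2 * r\<^sup>2 * (h \<bullet> (A_inv *v (y - x)))"
      by (simp add: matrix_vector_mult_scaleR power2_eq_square)
  qed
  finally show ?thesis .
qed

lemma bump_q_has_derivative:
  "((\<lambda>y. bump n (q (r *\<^sub>R (y - x)))) has_derivative
     (\<lambda>h. (real n * bump (Suc n) (q (r *\<^sub>R (y - x))) - bump (Suc (Suc n)) (q (r *\<^sub>R (y - x))))
          * (2 * r\<^sup>2 * (h \<bullet> (A_inv *v (y - x)))))) (at y)"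
  using has_derivative_compose[OF q_has_derivative bump_has_derivative[unfolded has_field_derivative_def]]
  by simp

lemma A_gradient_bump:
  "A *v gradient (\<lambda>y. bump 0 (q (r *\<^sub>R (y - x)))) y
   = (- 2 * r\<^sup>2 * bump 2 (q (r *\<^sub>R (y - x)))) *\<^sub>R (y - x)"
proof -
  have "gradient (\<lambda>y. bump 0 (q (r *\<^sub>R (y - x)))) y
      = (- 2 * r\<^sup>2 * bump 2 (q (r *\<^sub>R (y - x)))) *\<^sub>R (A_inv *v (y - x))"
    unfolding gradient_def
    by (simp add: partial_deriv_eq[OF bump_q_has_derivative] vec_eq_iff numeral_2_eq_2
        inner_axis' mult_ac)
  then show ?thesis by (simp only: matrix_vector_mult_scaleR A_mult_A_inv)
qed

text \<open>With \<open>f = bump 2\<close> and \<open>f' = 2 bump 3 - bump 4\<close> this is \<open>N f (s) + 2 s f' (s)\<close>. At \<open>s = q z\<close> it is the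
divergence of the field \<open>f (q z) z\<close>, and \<open>r ^ (N - 1)\<close> times its value at \<open>s = r\<^sup>2 q z\<close> is the
\<open>r\<close>-derivative of \<open>r ^ N f (r\<^sup>2 q z)\<close>. These two readings connect the equation with the kernel averages.\<close>

definition radial_div :: "real \<Rightarrow> real" where
  "radial_div s = real CARD('n) * bump 2 s + 2 * s * (2 * bump 3 s - bump 4 s)"

lemma partial_deriv_bump:
  "partial_deriv i (\<lambda>y. bump 2 (q (r *\<^sub>R (y - x))) * (y - x) $ i) y
   = bump 2 (q (r *\<^sub>R (y - x))) + (2 * bump 3 (q (r *\<^sub>R (y - x))) - bump 4 (q (r *\<^sub>R (y - x))))
      * (2 * r\<^sup>2 * ((y - x) $ i * (A_inv *v (y - x)) $ i))"
proof -
  have d: "((\<lambda>y. (y - x) $ i) has_derivative (\<lambda>h. h $ i)) (at y)"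
    by (auto intro!: derivative_eq_intros bounded_linear_imp_has_derivative bounded_linear_vec_nth)
  show ?thesis
    using partial_deriv_eq[OF has_derivative_mult[OF bump_q_has_derivative[of 2] d], of i]
    by (simp add: inner_axis' axis_def[of i 1 , THEN arg_cong[of _ _ "\<lambda>v. v $ i"]] eval_nat_numeral algebra_simps)
qed

text \<open>The components \<open>V i\<close> of the field \<open>bump 2 (q (r (y - x))) (y - x)\<close> are test functions, and \<open>V\<close> is
\<open>-1 / (2 r\<^sup>2)\<close> times \<open>A\<close> applied to the gradient of \<open>bump 0 (q (r (y - x)))\<close>. Moving the divergence of
\<open>V\<close> onto the weak gradient of \<open>u\<close> component by component therefore turns the integral into a multiple
of the subsolution inequality tested with this nonnegative bump.\<close>

lemma weak_subsolution_radial_div: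
  assumes u: "weak_subsolution A u" "continuous_on UNIV u" and r: "0 < r"
  shows "(LINT y|lebesgue. u y * radial_div (q (r *\<^sub>R (y - x)))) \<le> 0"
proof -
  obtain g where g: "has_weak_gradient u g"
    and sub: "\<And>\<phi>. test_function \<phi> \<Longrightarrow> (\<And>x. 0 \<le> \<phi> x) \<Longrightarrow> (LINT x|lebesgue. (A *v g x) \<bullet> gradient \<phi> x) \<le> 0"
    using u(1) by (auto simp: weak_subsolution_def)
  obtain \<rho> where \<rho>: "\<And>n y. bump n (q (r *\<^sub>R (y - x))) \<noteq> 0 \<Longrightarrow> y \<in> cball x (\<rho> / r)"
    using bump_support r by metis
  define V where "V i y = bump 2 (q (r *\<^sub>R (y - x))) * (y - x) $ i" for i y
  have V_poly: "bump_poly (V i)" for i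
  proof -
    have "bump_poly (\<lambda>y. bump 2 (q (r *\<^sub>R (y - x))) * (y $ i + - x $ i))"
      by (intro bump_poly.intros bump_poly_q)
    then show ?thesis by (simp add: V_def[abs_def])
  qed
  have V_bd: "bounded {y. V i y \<noteq> 0}" for i
    by (rule bounded_subset[OF bounded_cball[of x "\<rho> / r"]]) (use \<rho> in \<open>auto simp: V_def\<close>)
  have V_test: "test_function (V i)" for i
    by (intro test_function_bump_poly V_poly V_bd)
  have div: "(\<Sum>i\<in>UNIV. partial_deriv i (V i) y) = radial_div (q (r *\<^sub>R (y - x)))" for y
  proof -
    have "q (r *\<^sub>R (y - x)) = r\<^sup>2 * (\<Sum>i\<in>UNIV. (y - x) $ i * (A_inv *v (y - x)) $ i)"
      unfolding q_scaleR by (simp add: q_def inner_vec_def)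
    then show ?thesis
      unfolding V_def[abs_def] partial_deriv_bump radial_div_def
      by (simp add: sum.distrib flip: sum_distrib_left)
  qed
  have int1: "integrable lebesgue (\<lambda>y. u y * partial_deriv i (V i) y)" for i
  proof -
    obtain a where ab: "cball x (\<rho> / r) \<subseteq> cbox (- a) a"
      using bounded_subset_cbox_symmetric[OF bounded_cball] .
    show ?thesis
    proof (rule integral_continuous_bounded_support)
      show "continuous_on UNIV (\<lambda>y. u y * partial_deriv i (V i) y)"
        using bump_poly_deriv[OF V_poly[of i]] by (intro continuous_intros u bump_poly_continuous) auto
      show "y \<in> cbox (- a) a" if "u y * partial_deriv i (V i) y \<noteq> 0" for y
      proof -
        have "\<exists>n. bump n (q (r *\<^sub>R (y - x))) \<noteq> 0"
          by (rule ccontr) (use that[unfolded V_def[abs_def] partial_deriv_bump] in auto)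
        then show ?thesis using \<rho> ab by blast
      qed
    qed
  qed
  have int2: "integrable lebesgue (\<lambda>y. g y $ i * V i y)" for i
    using g by (intro integrable_L1_loc_mult bump_poly_continuous V_poly V_bd) (auto simp: has_weak_gradient_def)
  have "(LINT y|lebesgue. u y * radial_div (q (r *\<^sub>R (y - x))))
      = (\<Sum>i\<in>UNIV. LINT y|lebesgue. u y * partial_deriv i (V i) y)"
    by (simp add: div[symmetric] sum_distrib_left Bochner_Integration.integral_sum[OF int1])
  also have "\<dots> = (\<Sum>i\<in>UNIV. - (LINT y|lebesgue. g y $ i * V i y))"
    using g V_test by (auto simp: has_weak_gradient_def)
  also have "\<dots> = - (LINT y|lebesgue. (\<Sum>i\<in>UNIV. g y $ i * V i y))"
    by (simp add: sum_negf Bochner_Integration.integral_sum[OF int2])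
  also have "(\<lambda>y. \<Sum>i\<in>UNIV. g y $ i * V i y) =
      (\<lambda>y. (- 1 / (2 * r\<^sup>2)) * ((A *v g y) \<bullet> gradient (\<lambda>y. bump 0 (q (r *\<^sub>R (y - x)))) y))"
  proof
    fix y
    have "(A *v g y) \<bullet> gradient (\<lambda>y. bump 0 (q (r *\<^sub>R (y - x)))) y
        = - 2 * r\<^sup>2 * (bump 2 (q (r *\<^sub>R (y - x))) * (g y \<bullet> (y - x)))"
      by (simp only: self_adjoint A_gradient_bump inner_scaleR_right mult.assoc)
    moreover have "(\<Sum>i\<in>UNIV. g y $ i * V i y) = bump 2 (q (r *\<^sub>R (y - x))) * (g y \<bullet> (y - x))"
      by (simp add: V_def inner_vec_def sum_distrib_left mult_ac)
    ultimately show "(\<Sum>i\<in>UNIV. g y $ i * V i y)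
        = (- 1 / (2 * r\<^sup>2)) * ((A *v g y) \<bullet> gradient (\<lambda>y. bump 0 (q (r *\<^sub>R (y - x)))) y)"
      using r by simp
  qed
  also have "- (LINT y|lebesgue. (- 1 / (2 * r\<^sup>2)) * ((A *v g y) \<bullet> gradient (\<lambda>y. bump 0 (q (r *\<^sub>R (y - x)))) y))
      = 1 / (2 * r\<^sup>2) * (LINT y|lebesgue. (A *v g y) \<bullet> gradient (\<lambda>y. bump 0 (q (r *\<^sub>R (y - x)))) y)"
    by (subst integral_mult_right_zero) simp
  also have "\<dots> \<le> 0"
    using \<rho> by (intro mult_nonneg_nonpos sub test_function_bump_poly bump_poly.comp bump_poly_q bump_nonneg
        bounded_subset[OF bounded_cball[of x "\<rho> / r"]]) auto
  finally show ?thesis .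
qed

definition kernel_mass :: real where
  "kernel_mass = (LINT z|lebesgue. bump 2 (q z))"

lemma continuous_kernel: "continuous_on S (kernel r x)"
  by (intro bump_poly_continuous bump_poly.comp bump_poly_q)

lemma integrable_mult_kernel:
  assumes "continuous_on UNIV u" "0 < r"
  shows "integrable lebesgue (\<lambda>y. u y * kernel r x y)"
proof -
  obtain \<rho> where \<rho>: "\<And>n y. bump n (q (r *\<^sub>R (y - x))) \<noteq> 0 \<Longrightarrow> y \<in> cball x (\<rho> / r)"
    using bump_support assms(2) by metis
  obtain a where a: "cball x (\<rho> / r) \<subseteq> cbox (- a) a"
    using bounded_subset_cbox_symmetric[OF bounded_cball] .
  show ?thesis
    using \<rho> a by (intro integral_continuous_bounded_support(1)[of _ "- a" a] continuous_intros continuous_kernel assms) fastforce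
qed

text \<open>The averages of a subsolution increase when the scale \<open>1 / r\<close> increases, since their \<open>r\<close>-derivative
is \<open>r ^ (N - 1)\<close> times the integral in \<open>weak_subsolution_radial_div\<close>.\<close>

lemma kernel_average_antimono:
  assumes u: "weak_subsolution A u" "continuous_on UNIV u" and r: "0 < s" "s \<le> r"
  shows "r ^ CARD('n) * (LINT y|lebesgue. u y * kernel r x y) \<le> s ^ CARD('n) * (LINT y|lebesgue. u y * kernel s x y)"
proof -
  let ?N = "CARD('n)"
  obtain \<rho> where \<rho>: "0 < \<rho>" "\<And>n r x y. 0 < r \<Longrightarrow> bump n (q (r *\<^sub>R (y - x))) \<noteq> 0 \<Longrightarrow> y \<in> cball x (\<rho> / r)"
    using bump_support by metis
  \<comment> \<open>one box contains the supports for all parameters in the open interval \<open>{s / 2<..}\<close>, so that the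
      derivative can be taken under an integral over this fixed box, also at the end point \<open>s\<close>\<close>
  obtain a where a: "cball x (\<rho> / (s / 2)) \<subseteq> cbox (- a) a"
    using bounded_subset_cbox_symmetric[OF bounded_cball] .
  have supp: "y \<in> cbox (- a) a" if "s / 2 < t" "bump n (q (t *\<^sub>R (y - x))) \<noteq> 0" for t y n
  proof -
    have "y \<in> cball x (\<rho> / t)" using \<rho>(2) that r by auto
    moreover have "\<rho> / t \<le> \<rho> / (s / 2)" using that r \<rho>(1) by (intro divide_left_mono) auto
    ultimately show ?thesis using a by fastforce
  qed
  define F where "F t = integral (cbox (- a) a) (\<lambda>y. u y * (t ^ ?N * bump 2 (t\<^sup>2 * q (y - x))))" for t
  have F: "F t = t ^ ?N * (LINT y|lebesgue. u y * kernel t x y)" if t: "s / 2 < t" for t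
  proof -
    have "F t = (LINT y|lebesgue. u y * (t ^ ?N * bump 2 (t\<^sup>2 * q (y - x))))"
      unfolding F_def
      by (intro integral_continuous_bounded_support(2)[symmetric] continuous_intros continuous_bump u)
         (use supp[OF t, of 2] in \<open>auto simp: q_scaleR\<close>)
    also have "\<dots> = (LINT y|lebesgue. t ^ ?N * (u y * kernel t x y))"
      by (simp add: q_scaleR mult_ac)
    finally show ?thesis by simp
  qed
  have D: "(F has_real_derivative
      integral (cbox (- a) a) (\<lambda>y. u y * (t ^ (?N - 1) * radial_div (t\<^sup>2 * q (y - x))))) (at t)"
    if t: "s / 2 < t" for t
  proof -
    have "(F has_real_derivative
      integral (cbox (- a) a) (\<lambda>y. u y * (t ^ (?N - 1) * radial_div (t\<^sup>2 * q (y - x))))) (at t within {s/2<..})"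
      unfolding F_def
    proof (rule leibniz_rule_field_derivative)
      fix t y assume "t \<in> {s / 2<..}"
      then have t0: "t > 0" using r by simp
      have "((\<lambda>t. u y * (t ^ ?N * bump 2 (t\<^sup>2 * q (y - x)))) has_real_derivative
         u y * (t ^ (?N - 1) * radial_div (t\<^sup>2 * q (y - x)))) (at t)"
      proof -
        obtain k where k: "?N = Suc k" using zero_less_card_finite[where 'a = 'n] gr0_implies_Suc by blast
        have d: "((\<lambda>t. bump 2 (t\<^sup>2 * q (y - x))) has_real_derivative
            (2 * bump 3 (t\<^sup>2 * q (y - x)) - bump 4 (t\<^sup>2 * q (y - x))) * (2 * t * q (y - x))) (at t)"
          by (rule DERIV_chain2[OF bump_has_derivative[of 2, simplified, folded numeral_3_eq_3]])
             (auto intro!: derivative_eq_intros)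
        show ?thesis
          by (rule derivative_eq_intros d refl)+ (simp add: k radial_div_def power2_eq_square algebra_simps)
      qed
      then show "((\<lambda>t. u y * (t ^ ?N * bump 2 (t\<^sup>2 * q (y - x)))) has_real_derivative
         u y * (t ^ (?N - 1) * radial_div (t\<^sup>2 * q (y - x)))) (at t within {s / 2<..})"
        by (rule has_field_derivative_at_within)
    next
      fix t :: real
      show "(\<lambda>y. u y * (t ^ ?N * bump 2 (t\<^sup>2 * q (y - x)))) integrable_on cbox (- a) a"
        by (intro integrable_continuous continuous_intros continuous_bump continuous_on_subset[OF u(2)]) auto
    next
      show "continuous_on ({s / 2<..} \<times> cbox (- a) a) (\<lambda>(t, y). u y * (t ^ (?N - 1) * radial_div (t\<^sup>2 * q (y - x))))"
        unfolding radial_div_def case_prod_unfold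
        by (intro continuous_intros continuous_bump continuous_on_compose2[OF u(2)]) auto
    qed (use t in auto)
    moreover have "at t within {s / 2<..} = at t" using t by (intro at_within_open) auto
    ultimately show ?thesis by (simp only:)
  qed
  have neg: "integral (cbox (- a) a) (\<lambda>y. u y * (t ^ (?N - 1) * radial_div (t\<^sup>2 * q (y - x)))) \<le> 0"
    if t: "s / 2 < t" for t
  proof -
    have "integral (cbox (- a) a) (\<lambda>y. u y * (t ^ (?N - 1) * radial_div (t\<^sup>2 * q (y - x))))
       = (LINT y|lebesgue. u y * (t ^ (?N - 1) * radial_div (t\<^sup>2 * q (y - x))))"
    proof (rule integral_continuous_bounded_support(2)[symmetric])
      show "continuous_on UNIV (\<lambda>y. u y * (t ^ (?N - 1) * radial_div (t\<^sup>2 * q (y - x))))"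
        unfolding radial_div_def by (intro continuous_intros continuous_bump u)
      fix y assume *: "u y * (t ^ (?N - 1) * radial_div (t\<^sup>2 * q (y - x))) \<noteq> 0"
      have "\<exists>n. bump n (q (t *\<^sub>R (y - x))) \<noteq> 0"
        by (rule ccontr) (use * in \<open>auto simp: radial_div_def q_scaleR\<close>)
      then show "y \<in> cbox (- a) a" using supp[OF t] by blast
    qed
    also have "\<dots> = (LINT y|lebesgue. t ^ (?N - 1) * (u y * radial_div (q (t *\<^sub>R (y - x)))))"
      by (simp add: q_scaleR mult_ac)
    also have "\<dots> = t ^ (?N - 1) * (LINT y|lebesgue. u y * radial_div (q (t *\<^sub>R (y - x))))"
      by simp
    also have "\<dots> \<le> 0"
      using t r by (intro mult_nonneg_nonpos weak_subsolution_radial_div u) auto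
    finally show ?thesis .
  qed
  have "F r \<le> F s"
  proof (rule DERIV_nonpos_imp_nonincreasing[OF r(2)])
    fix t assume "s \<le> t" "t \<le> r"
    then have "s / 2 < t" using r by auto
    then show "\<exists>y. (F has_real_derivative y) (at t) \<and> y \<le> 0" using D neg by blast
  qed
  then show ?thesis using F[of r] F[of s] r by simp
qed

lemma integral_kernel:
  assumes "0 < r"
  shows "r ^ CARD('n) * (LINT y|lebesgue. kernel r x y) = kernel_mass"
proof -
  let ?T = "\<lambda>z. x + (1 / r) *\<^sub>R z"
  have [measurable]: "kernel r x \<in> borel_measurable borel"
    by (intro borel_measurable_continuous_onI continuous_kernel)
  have m2: "(\<lambda>z. bump 2 (q z)) \<in> borel_measurable borel"
    by (intro borel_measurable_continuous_onI continuous_bump continuous_intros)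
  have "(LINT y|lborel. kernel r x y) =
      (LINT y|density (distr lborel borel ?T) (\<lambda>_. ennreal (\<bar>1 / r\<bar> ^ CARD('n))). kernel r x y)"
    using lborel_affine[of "1 / r" x] assms by simp
  also have "\<dots> = \<bar>1 / r\<bar> ^ CARD('n) * (LINT z|lborel. kernel r x (?T z))"
    by (subst integral_density) (auto simp: integral_distr)
  also have "(\<lambda>z. kernel r x (?T z)) = (\<lambda>z. bump 2 (q z))"
    using assms by simp
  finally have "(LINT y|lborel. kernel r x y) = \<bar>1 / r\<bar> ^ CARD('n) * (LINT z|lborel. bump 2 (q z))" .
  then show ?thesis
    unfolding kernel_mass_def using assms m2
    by (simp add: integral_completion power_divide)
qed

lemma kernel_lower:
  obtains c m where "0 < c" "0 < m" "\<And>z. norm z \<le> c \<Longrightarrow> m \<le> bump 2 (q z)"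
proof -
  have "continuous_on UNIV (\<lambda>z. bump 2 (q z))" by (intro continuous_bump continuous_intros)
  then have "isCont (\<lambda>z. bump 2 (q z)) 0" by (simp add: continuous_on_eq_continuous_at)
  moreover have pos: "bump 2 (q 0) > 0" by (simp add: bump_def q_def)
  ultimately obtain d where d: "d > 0" "\<And>z. dist z 0 < d \<Longrightarrow> dist (bump 2 (q z)) (bump 2 (q 0)) < bump 2 (q 0) / 2"
    unfolding continuous_at_eps_delta by (meson half_gt_zero)
  show thesis
  proof (rule that[of "d / 2" "bump 2 (q 0) / 2"])
    fix z :: "real^'n" assume "norm z \<le> d / 2"
    then have "dist (bump 2 (q z)) (bump 2 (q 0)) < bump 2 (q 0) / 2" using d by auto
    then show "bump 2 (q 0) / 2 \<le> bump 2 (q z)" unfolding dist_real_def by linarith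
  qed (use d pos in auto)
qed

lemma kernel_mass_pos: "0 < kernel_mass"
proof -
  obtain c m where c: "0 < c" "0 < m" "\<And>z. norm z \<le> c \<Longrightarrow> m \<le> bump 2 (q z)"
    using kernel_lower by blast
  have int: "integrable lebesgue (\<lambda>z. bump 2 (q z))"
    using integrable_mult_kernel[of "\<lambda>_. 1" 1 0] by simp
  have "0 < m * measure lebesgue (cball (0::real^'n) c)"
    using c by simp
  also have "\<dots> = (LINT z|lebesgue. m * indicator (cball (0::real^'n) c) z)" by simp
  also have "\<dots> \<le> kernel_mass"
    unfolding kernel_mass_def
    by (intro integral_mono int integrable_mult_right lmeasurable_iff_integrable[THEN iffD1] lmeasurable_cball)
       (use c in \<open>auto simp: indicator_def bump_nonneg\<close>)
  finally show ?thesis .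
qed

text \<open>By monotonicity the average at scale \<open>1 / r\<close> is at least the one at any smaller scale, and these tend
to \<open>kernel_mass * u x\<close> because \<open>u\<close> is continuous and the supports shrink to \<open>x\<close>.\<close>

lemma sub_mean_value:
  assumes u: "weak_subsolution A u" "continuous_on UNIV u" and r: "0 < r"
  shows "kernel_mass * u x \<le> r ^ CARD('n) * (LINT y|lebesgue. u y * kernel r x y)"
    (is "_ \<le> ?I")
proof (rule field_le_epsilon)
  let ?N = "CARD('n)"
  fix e :: real assume "0 < e"
  define e' where "e' = e / kernel_mass"
  have "0 < e'" using \<open>0 < e\<close> kernel_mass_pos by (simp add: e'_def)
  moreover have "isCont u x" using u(2) by (simp add: continuous_on_eq_continuous_at)
  ultimately obtain d where d: "0 < d" "\<And>y. dist y x < d \<Longrightarrow> dist (u y) (u x) < e'"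
    unfolding continuous_at_eps_delta by blast
  obtain \<rho> where \<rho>: "0 < \<rho>" "\<And>n r y. 0 < r \<Longrightarrow> bump n (q (r *\<^sub>R (y - x))) \<noteq> 0 \<Longrightarrow> y \<in> cball x (\<rho> / r)"
    using bump_support by metis
  define s where "s = max r (2 * \<rho> / d)"
  have s: "r \<le> s" "0 < s" "\<rho> / s < d"
  proof -
    show "r \<le> s" "0 < s" using r by (auto simp: s_def)
    have "2 * \<rho> / d \<le> s" by (simp add: s_def)
    then show "\<rho> / s < d" using d(1) \<rho>(1) \<open>0 < s\<close> by (simp add: field_simps)
  qed
  have "(u x - e') * kernel_mass = s ^ ?N * (LINT y|lebesgue. (u x - e') * kernel s x y)"
    using integral_kernel[OF s(2), of x] by simp
  also have "\<dots> \<le> s ^ ?N * (LINT y|lebesgue. u y * kernel s x y)"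
  proof (intro mult_left_mono integral_mono integrable_mult_kernel u s continuous_intros)
    fix y
    show "(u x - e') * kernel s x y \<le> u y * kernel s x y"
    proof (cases "kernel s x y = 0")
      case False
      then have "y \<in> cball x (\<rho> / s)" using \<rho> s by blast
      then have "dist y x < d" using s by (simp add: dist_commute)
      then have "dist (u y) (u x) < e'" by (rule d)
      then show ?thesis by (intro mult_right_mono bump_nonneg) (auto simp: dist_real_def)
    qed simp
  qed (use s in auto)
  also have "\<dots> \<le> ?I"
    by (intro kernel_average_antimono u r s)
  finally have "(u x - e') * kernel_mass \<le> ?I" .
  moreover have "(u x - e') * kernel_mass = kernel_mass * u x - e"
    using kernel_mass_pos by (simp add: e'_def left_diff_distrib)
  ultimately show "kernel_mass * u x \<le> ?I + e" by linarith
qed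

end

section \<open>Decay of subsolutions that vanish on half of a ball\<close>

text \<open>A subsolution that vanishes on at least half of the ball of radius \<open>R\<close> loses the fixed fraction \<open>\<delta>\<close>
of its upper bound when passing from the ball of radius \<open>L R\<close> to that of radius \<open>R\<close>. The two constants
are the same at all scales, which is what makes iteration possible.\<close>

definition half_zero_decay :: "real^'n^'n \<Rightarrow> real \<Rightarrow> real \<Rightarrow> bool" where
  "half_zero_decay A \<delta> L \<longleftrightarrow> (\<forall>u R M. weak_subsolution A u \<and> continuous_on UNIV u \<and> (\<forall>x. 0 \<le> u x) \<and> 0 < R \<and>
     (\<forall>y\<in>cball 0 (L * R). u y \<le> M) \<and>
     measure lebesgue (cball (0::real^'n) R) \<le> 2 * measure lebesgue {y\<in>cball 0 R. u y = 0}
     \<longrightarrow> (\<forall>x\<in>cball 0 R. u x \<le> (1 - \<delta>) * M))"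

text \<open>In the mean value inequality at a scale comparable to \<open>R\<close>, the kernel is bounded below on the whole
ball of radius \<open>R\<close>, hence on the zero set of \<open>u\<close>. That set carries a fixed fraction of the mass of the
kernel and contributes nothing to the average of \<open>u\<close>.\<close>

lemma (in elliptic_matrix) exists_decay: "\<exists>\<delta> L. 0 < \<delta> \<and> \<delta> < 1 \<and> 0 \<le> L \<and> half_zero_decay A \<delta> L"
proof -
  let ?N = "CARD('n)"
  let ?V = "unit_ball_vol (real ?N)"
  obtain c' m where c': "0 < c'" "0 < m" "\<And>z. norm z \<le> c' \<Longrightarrow> m \<le> bump 2 (q z)"
    using kernel_lower by blast
  \<comment> \<open>two points of the ball of radius \<open>R\<close> are at distance at most \<open>2 R\<close>; with the parameter
      \<open>r = c / R\<close> used below their scaled difference has norm at most \<open>2 c = c'\<close>\<close>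
  define c where "c = c' / 2"
  have c: "0 < c" "\<And>z. norm z \<le> 2 * c \<Longrightarrow> m \<le> bump 2 (q z)"
    using c' by (auto simp: c_def)
  obtain \<rho> where \<rho>: "0 < \<rho>" "\<And>n r x y. 0 < r \<Longrightarrow> bump n (q (r *\<^sub>R (y - x))) \<noteq> 0 \<Longrightarrow> y \<in> cball x (\<rho> / r)"
    using bump_support by metis
  define L where "L = 1 + \<rho> / c"
  have L: "0 \<le> L" using \<rho> c by (simp add: L_def)
  define \<eta> where "\<eta> = m * c ^ ?N * ?V / (2 * kernel_mass)"
  \<comment> \<open>\<open>\<eta>\<close> is the fraction of the mass lost; the minimum only ensures that \<open>\<delta> < 1\<close>\<close>
  define \<delta> where "\<delta> = min \<eta> (1 / 2)"
  have "0 < \<eta>" using c c' kernel_mass_pos by (simp add: \<eta>_def)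
  then have \<delta>: "0 < \<delta>" "\<delta> < 1" "\<delta> \<le> \<eta>" by (auto simp: \<delta>_def)
  have "half_zero_decay A \<delta> L"
    unfolding half_zero_decay_def
  proof (intro allI impI ballI, elim conjE)
    fix u :: "real^'n \<Rightarrow> real" and R M :: real and x :: "real^'n"
    assume u: "weak_subsolution A u" "continuous_on UNIV u" "\<forall>x. 0 \<le> u x" and R: "0 < R"
      and M: "\<forall>y\<in>cball 0 (L * R). u y \<le> M"
      and half: "measure lebesgue (cball (0::real^'n) R) \<le> 2 * measure lebesgue {y\<in>cball 0 R. u y = 0}"
      and x: "x \<in> cball 0 R"
    define r where "r = c / R"
    have r: "0 < r" using c R by (simp add: r_def)
    define Z where "Z = {y\<in>cball 0 R. u y = 0}"
    have "closed Z"
    proof -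
      have "Z = cball 0 R \<inter> u -` {0}" by (auto simp: Z_def)
      then show ?thesis using u(2) by (auto intro!: closed_Int continuous_closed_vimage simp: continuous_on_eq_continuous_at)
    qed
    moreover have "bounded Z" by (rule bounded_subset[OF bounded_cball[of 0 R]]) (auto simp: Z_def)
    ultimately have Z: "compact Z" by (simp add: compact_eq_bounded_closed)
    then have Zint: "integrable lebesgue (indicator Z :: _ \<Rightarrow> real)"
      by (intro lmeasurable_iff_integrable[THEN iffD1] lmeasurable_compact)
    have "u 0 \<le> M" using M R L by simp
    with u(3) have "0 \<le> M" using order_trans by blast
    have wint: "integrable lebesgue (kernel r x)"
      using integrable_mult_kernel[of "\<lambda>_. 1" r x] r by simp
    have "kernel_mass * u x \<le> r ^ ?N * (LINT y|lebesgue. u y * kernel r x y)"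
      by (intro sub_mean_value u r)
    also have "\<dots> \<le> r ^ ?N * (LINT y|lebesgue. M * (kernel r x y - m * indicator Z y))"
    proof (intro mult_left_mono integral_mono integrable_mult_kernel u r)
      show "integrable lebesgue (\<lambda>y. M * (kernel r x y - m * indicator Z y))"
        by (intro integrable_mult_right Bochner_Integration.integrable_diff wint Zint)
      fix y
      show "u y * kernel r x y \<le> M * (kernel r x y - m * indicator Z y)"
      proof (cases "y \<in> Z")
        case True
        then have "norm y \<le> R" "u y = 0" by (auto simp: Z_def)
        moreover have "norm (y - x) \<le> 2 * R"
          using x \<open>norm y \<le> R\<close> norm_triangle_ineq4[of y x] by simp
        then have "r * norm (y - x) \<le> r * (2 * R)" using r by (intro mult_left_mono) auto
        then have "norm (r *\<^sub>R (y - x)) \<le> 2 * c" using R c by (simp add: r_def)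
        then have "m \<le> kernel r x y" by (rule c)
        ultimately show ?thesis using True \<open>0 \<le> M\<close> by simp
      next
        case False
        show ?thesis
        proof (cases "kernel r x y = 0")
          case nz: False
          then have "y \<in> cball x (\<rho> / r)" using \<rho> r by blast
          then have "norm (y - x) \<le> \<rho> / c * R" by (simp add: dist_norm norm_minus_commute r_def)
          then have "norm y \<le> L * R" using x norm_triangle_ineq[of x "y - x"] by (simp add: L_def algebra_simps)
          then have "u y \<le> M" using M by simp
          then show ?thesis using False by (simp add: mult_right_mono bump_nonneg)
        qed (use False in simp)
      qed
    qed (use r in auto)
    also have "\<dots> = M * (r ^ ?N * (LINT y|lebesgue. kernel r x y) - m * r ^ ?N * measure lebesgue Z)"
      using Zint wint by (simp add: algebra_simps)
    also have "\<dots> = M * (kernel_mass - m * r ^ ?N * measure lebesgue Z)"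
      using integral_kernel[OF r] by simp
    also have "\<dots> \<le> M * (kernel_mass - m * r ^ ?N * (?V * R ^ ?N / 2))"
    proof -
      have "?V * R ^ ?N / 2 \<le> measure lebesgue Z"
        using half R by (simp add: Z_def content_cball)
      then show ?thesis using \<open>0 \<le> M\<close> c' r by (intro mult_left_mono diff_left_mono) auto
    qed
    also have "m * r ^ ?N * (?V * R ^ ?N / 2) = kernel_mass * \<eta>"
      using kernel_mass_pos R by (simp add: \<eta>_def r_def power_divide)
    also have "M * (kernel_mass - kernel_mass * \<eta>) = kernel_mass * ((1 - \<eta>) * M)"
      by (simp add: algebra_simps)
    finally have "u x \<le> (1 - \<eta>) * M" using kernel_mass_pos by simp
    also have "\<dots> \<le> (1 - \<delta>) * M" using \<delta> \<open>0 \<le> M\<close> by (intro mult_right_mono) auto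
    finally show "u x \<le> (1 - \<delta>) * M" .
  qed
  with \<delta> L show ?thesis by blast
qed

lemma half_zero_decayD:
  fixes A :: "real^'n^'n"
  assumes "half_zero_decay A \<delta> L" "weak_subsolution A u" "continuous_on UNIV u" "\<forall>x. 0 \<le> u x" "0 < R"
    and "\<forall>y\<in>cball 0 (L * R). u y \<le> M"
    and "measure lebesgue (cball (0::real^'n) R) \<le> 2 * measure lebesgue {y\<in>cball 0 R. u y = 0}"
    and "x \<in> cball 0 R"
  shows "u x \<le> (1 - \<delta>) * M"
proof -
  note d = assms(1)[unfolded half_zero_decay_def, THEN spec[of _ u], THEN spec[of _ R], THEN spec[of _ M]]
  have "\<forall>x\<in>cball 0 R. u x \<le> (1 - \<delta>) * M"
    by (rule d[THEN mp]) (intro conjI assms(2-7))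
  with assms(8) show ?thesis by (rule bspec[rotated])
qed

lemma half_zero_decay_weaken:
  fixes A :: "real^'n^'n"
  assumes "half_zero_decay A \<delta> L" "\<delta>' \<le> \<delta>" "0 \<le> L" "L \<le> L'"
  shows "half_zero_decay A \<delta>' L'"
  unfolding half_zero_decay_def
proof (intro allI impI, elim conjE)
  fix u :: "real^'n \<Rightarrow> real" and R M
  assume u: "weak_subsolution A u" "continuous_on UNIV u" "\<forall>x. 0 \<le> u x" and R: "0 < R"
    and M: "\<forall>y\<in>cball 0 (L' * R). u y \<le> M"
    and half: "measure lebesgue (cball (0::real^'n) R) \<le> 2 * measure lebesgue {y\<in>cball 0 R. u y = 0}"
  have "L * R \<le> L' * R" using R assms by (intro mult_right_mono) auto
  then have M': "\<forall>y\<in>cball 0 (L * R). u y \<le> M"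
    by (intro ballI M[THEN bspec]) simp
  have "0 \<in> cball (0::real^'n) (L' * R)" using R assms(3,4) by simp
  with M have "u 0 \<le> M" by (rule bspec)
  with u(3)[THEN spec, of 0] have "0 \<le> M" by linarith
  then have le: "(1 - \<delta>) * M \<le> (1 - \<delta>') * M" using assms(2) by (intro mult_right_mono) auto
  show "\<forall>x\<in>cball 0 R. u x \<le> (1 - \<delta>') * M"
  proof
    fix x :: "real^'n" assume "x \<in> cball 0 R"
    then have "u x \<le> (1 - \<delta>) * M"
      by (rule half_zero_decayD[OF assms(1) u R M' half])
    with le show "u x \<le> (1 - \<delta>') * M" by linarith
  qed
qed

lemma uniform_decay:
  fixes A :: "'i \<Rightarrow> real^'n^'n"
  assumes "finite I" "\<And>i. i \<in> I \<Longrightarrow> elliptic_matrix (A i)"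
  obtains \<delta> L where "0 < \<delta>" "\<delta> < 1" "2 \<le> L" "\<And>i. i \<in> I \<Longrightarrow> half_zero_decay (A i) \<delta> L"
proof -
  have "\<exists>\<delta> L. 0 < \<delta> \<and> \<delta> < 1 \<and> 2 \<le> L \<and> (\<forall>i\<in>I. half_zero_decay (A i) \<delta> L)"
    using assms
  proof (induction I rule: finite_induct)
    case empty
    show ?case by (rule exI[of _ "1/2"], rule exI[of _ 2]) simp
  next
    case (insert j I)
    then obtain \<delta> L where 1: "0 < \<delta>" "\<delta> < 1" "2 \<le> L" "\<forall>i\<in>I. half_zero_decay (A i) \<delta> L"
      by auto
    obtain \<delta>' L' where 2: "0 < \<delta>'" "\<delta>' < 1" "0 \<le> L'" "half_zero_decay (A j) \<delta>' L'"
      using elliptic_matrix.exists_decay[OF insert.prems[of j]] by auto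
    have "half_zero_decay (A i) (min \<delta> \<delta>') (max L L')" if "i \<in> insert j I" for i
    proof (cases "i = j")
      case True
      show ?thesis unfolding True by (rule half_zero_decay_weaken[OF 2(4)]) (use 2 in auto)
    next
      case False
      with that have "half_zero_decay (A i) \<delta> L" using 1(4) by blast
      then show ?thesis by (rule half_zero_decay_weaken) (use 1 in auto)
    qed
    with 1 2 show ?case
      by (intro exI[of _ "min \<delta> \<delta>'"] exI[of _ "max L L'"]) auto
  qed
  with that show thesis by blast
qed

section \<open>Two subsolutions with disjoint supports\<close>

lemma zero_sets_share_ball:
  fixes u v :: "real^'n \<Rightarrow> real"
  assumes "continuous_on UNIV u" "continuous_on UNIV v" "\<And>x. u x * v x = 0"
  shows "measure lebesgue (cball (0::real^'n) R) \<le> 2 * measure lebesgue {y\<in>cball (0::real^'n) R. u y = 0} \<or>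
         measure lebesgue (cball (0::real^'n) R) \<le> 2 * measure lebesgue {y\<in>cball (0::real^'n) R. v y = 0}"
proof -
  have zero: "{y\<in>cball (0::real^'n) R. w y = 0} \<in> lmeasurable" if "continuous_on UNIV w" for w :: "real^'n \<Rightarrow> real"
  proof (rule lmeasurable_compact)
    have "{y\<in>cball (0::real^'n) R. w y = 0} = cball (0::real^'n) R \<inter> w -` {0}" by auto
    moreover have "closed (w -` {0})"
      using that by (intro continuous_closed_vimage) (auto simp: continuous_on_eq_continuous_at)
    ultimately show "compact {y\<in>cball (0::real^'n) R. w y = 0}" by (simp add: compact_Int_closed)
  qed
  let ?U = "{y\<in>cball (0::real^'n) R. u y = 0}" and ?V = "{y\<in>cball (0::real^'n) R. v y = 0}"
  have ball: "cball (0::real^'n) R = ?U \<union> ?V"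
    using assms(3) by auto
  have "measure lebesgue (?U \<union> ?V) \<le> measure lebesgue ?U + measure lebesgue ?V"
    by (intro measure_Un_le fmeasurableD zero assms)
  then have "measure lebesgue (cball (0::real^'n) R) \<le> measure lebesgue ?U + measure lebesgue ?V"
    by (simp only: ball[symmetric])
  then show ?thesis by linarith
qed

text \<open>At every scale one of the two zero sets fills at least half of the ball, so one of the two upper
bounds improves by the factor \<open>1 - \<delta>\<close>. Which one improves may change from scale to scale, but the product
of the bounds always does. The bounds \<open>a\<close> and \<open>b\<close> vary in the induction, which proceeds from the
largest ball inwards.\<close>

lemma product_decay:
  fixes u v :: "real^'n \<Rightarrow> real"
  assumes decay: "half_zero_decay A \<delta> L" "half_zero_decay A' \<delta> L" and \<delta>: "\<delta> < 1" and L: "1 \<le> L"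
    and u: "weak_subsolution A u" "continuous_on UNIV u" "\<forall>x. 0 \<le> u x"
    and v: "weak_subsolution A' v" "continuous_on UNIV v" "\<forall>x. 0 \<le> v x"
    and uv: "\<And>x. u x * v x = 0" and R: "0 < R"
    and a: "\<And>y. y \<in> cball 0 (L ^ n * R) \<Longrightarrow> u y \<le> a"
    and b: "\<And>y. y \<in> cball 0 (L ^ n * R) \<Longrightarrow> v y \<le> b"
    and xy: "x \<in> cball 0 R" "y \<in> cball 0 R"
  shows "u x * v y \<le> (1 - \<delta>) ^ n * (a * b)"
  using a b
proof (induction n arbitrary: a b)
  case 0
  then have "u x \<le> a" "v y \<le> b" using xy by auto
  moreover have "0 \<le> a" using u(3)[rule_format, of x] \<open>u x \<le> a\<close> by linarith
  ultimately show ?case using v(3)[rule_format, of y] by (simp add: mult_mono)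
next
  case (Suc n)
  let ?R = "L ^ n * R"
  have R': "0 < ?R" using L R by (intro mult_pos_pos zero_less_power) linarith+
  have eq: "L ^ Suc n * R = L * ?R" by simp
  have ball: "\<forall>y\<in>cball 0 (L * ?R). u y \<le> a" "\<forall>y\<in>cball 0 (L * ?R). v y \<le> b"
    using Suc.prems unfolding eq by blast+
  have small: "cball 0 ?R \<subseteq> cball (0::real^'n) (L * ?R)"
    using R' mult_right_mono[OF L, of ?R] by (intro subset_cball) simp
  have "measure lebesgue (cball (0::real^'n) ?R) \<le> 2 * measure lebesgue {y\<in>cball 0 ?R. u y = 0} \<or>
        measure lebesgue (cball (0::real^'n) ?R) \<le> 2 * measure lebesgue {y\<in>cball 0 ?R. v y = 0}"
    by (intro zero_sets_share_ball u v uv)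
  then show ?case
  proof
    assume half: "measure lebesgue (cball (0::real^'n) ?R) \<le> 2 * measure lebesgue {y\<in>cball 0 ?R. u y = 0}"
    have *: "u y \<le> (1 - \<delta>) * a" if "y \<in> cball 0 ?R" for y
      using that by (rule half_zero_decayD[OF decay(1) u R' ball(1) half])
    have "u x * v y \<le> (1 - \<delta>) ^ n * ((1 - \<delta>) * a * b)"
    proof (rule Suc.IH)
      fix y :: "real^'n" assume "y \<in> cball 0 ?R"
      then show "u y \<le> (1 - \<delta>) * a" "v y \<le> b"
        using * ball(2) small by blast+
    qed
    then show ?thesis by (simp add: mult_ac)
  next
    assume half: "measure lebesgue (cball (0::real^'n) ?R) \<le> 2 * measure lebesgue {y\<in>cball 0 ?R. v y = 0}"
    have *: "v y \<le> (1 - \<delta>) * b" if "y \<in> cball 0 ?R" for y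
      using that by (rule half_zero_decayD[OF decay(2) v R' ball(2) half])
    have "u x * v y \<le> (1 - \<delta>) ^ n * (a * ((1 - \<delta>) * b))"
    proof (rule Suc.IH)
      fix y :: "real^'n" assume "y \<in> cball 0 ?R"
      then show "u y \<le> a" "v y \<le> (1 - \<delta>) * b"
        using * ball(1) small by blast+
    qed
    then show ?thesis by (simp add: mult_ac)
  qed
qed

text \<open>On the ball of radius \<open>L ^ n R\<close> the product of the bounds grows at most like \<open>L powr (\<alpha> + \<beta>)\<close> to the
power \<open>n\<close>, which is too slow to compensate the gain \<open>(1 - \<delta>) ^ n\<close>.\<close>

lemma slow_growth_imp_zero:
  fixes u v :: "real^'n \<Rightarrow> real"
  assumes decay: "half_zero_decay A \<delta> L" "half_zero_decay A' \<delta> L" and \<delta>: "\<delta> < 1" and L: "1 \<le> L"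
    and u: "weak_subsolution A u" "continuous_on UNIV u" "\<forall>x. 0 \<le> u x"
    and v: "weak_subsolution A' v" "continuous_on UNIV v" "\<forall>x. 0 \<le> v x"
    and uv: "\<And>x. u x * v x = 0"
    and growth_u: "0 < C" "0 < \<alpha>" "\<And>x. u x \<le> C * (1 + norm x powr \<alpha>)"
    and growth_v: "0 < D" "0 < \<beta>" "\<And>x. v x \<le> D * (1 + norm x powr \<beta>)"
    and slow: "(1 - \<delta>) * L powr (\<alpha> + \<beta>) < 1"
  shows "(\<forall>x. u x = 0) \<or> (\<forall>x. v x = 0)"
proof (rule ccontr)
  assume "\<not> ?thesis"
  then obtain x y where xy: "u x \<noteq> 0" "v y \<noteq> 0" by blast
  then have pos: "0 < u x * v y" using u(3)[rule_format, of x] v(3)[rule_format, of y] by simp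
  define R where "R = 1 + norm x + norm y"
  have R: "1 \<le> R" "x \<in> cball 0 R" "y \<in> cball 0 R" by (auto simp: R_def)
  define t where "t = (1 - \<delta>) * L powr (\<alpha> + \<beta>)"
  have t: "0 \<le> t" "t < 1" using slow \<delta> by (auto simp: t_def)
  have growth: "w z \<le> 2 * c * (L ^ n * R) powr \<gamma>"
    if w: "\<And>x. w x \<le> c * (1 + norm x powr \<gamma>)" "0 < c" "0 < \<gamma>" and z: "z \<in> cball 0 (L ^ n * R)"
    for w :: "real^'n \<Rightarrow> real" and c \<gamma> z n
  proof -
    have "1 * 1 \<le> L ^ n * R" using L R one_le_power by (intro mult_mono) auto
    then have "1 \<le> (L ^ n * R) powr \<gamma>" using w(3) by (intro ge_one_powr_ge_zero) auto
    moreover have "norm z powr \<gamma> \<le> (L ^ n * R) powr \<gamma>"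
      using z w(3) by (intro powr_mono2) auto
    ultimately have "c * (1 + norm z powr \<gamma>) \<le> c * (2 * (L ^ n * R) powr \<gamma>)"
      using w(2) by (intro mult_left_mono) auto
    with w(1)[of z] show ?thesis by simp
  qed
  have "u x * v y \<le> 4 * C * D * R powr (\<alpha> + \<beta>) * t ^ n" for n
  proof -
    have "u x * v y \<le> (1 - \<delta>) ^ n * ((2 * C * (L ^ n * R) powr \<alpha>) * (2 * D * (L ^ n * R) powr \<beta>))"
      by (rule product_decay[OF decay \<delta> L u v uv _ growth[OF growth_u(3,1,2)] growth[OF growth_v(3,1,2)]])
         (use R in auto)
    also have "\<dots> = 4 * C * D * ((1 - \<delta>) ^ n * (L ^ n * R) powr (\<alpha> + \<beta>))"
      by (simp only: powr_add) (simp add: mult_ac)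
    also have "(L ^ n * R) powr (\<alpha> + \<beta>) = R powr (\<alpha> + \<beta>) * (L powr (\<alpha> + \<beta>)) ^ n"
    proof -
      have "(L ^ n) powr s = (L powr s) ^ n" for s
        using L by (induction n) (auto simp: powr_mult)
      then show ?thesis using L R by (simp add: powr_mult)
    qed
    finally show ?thesis by (simp add: t_def power_mult_distrib mult_ac)
  qed
  then have "\<exists>N. \<forall>n\<ge>N. u x * v y \<le> 4 * C * D * R powr (\<alpha> + \<beta>) * t ^ n" by blast
  moreover have "(\<lambda>n. 4 * C * D * R powr (\<alpha> + \<beta>) * t ^ n) \<longlonglongrightarrow> 4 * C * D * R powr (\<alpha> + \<beta>) * 0"
    using t by (intro tendsto_intros LIMSEQ_realpow_zero)
  ultimately have "u x * v y \<le> 4 * C * D * R powr (\<alpha> + \<beta>) * 0"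
    by (rule LIMSEQ_le_const[rotated])
  with pos show False by simp
qed

theorem theorem3p1:
  fixes k :: nat and A :: "nat \<Rightarrow> real^'n^'n"
  assumes "2 \<le> k" and "2 \<le> CARD('n)"
    and "\<forall>i\<in>{1..k}. transpose (A i) = A i \<and> positive_definite (A i)"
  shows "\<exists>\<nu>::real. 0 < \<nu> \<and> \<nu> < 2 \<and>
    (\<forall>(u :: nat \<Rightarrow> real^'n \<Rightarrow> real) (\<alpha> :: nat \<Rightarrow> real).
      (\<forall>i\<in>{1..k}. H1_loc (u i) \<and> continuous_on UNIV (u i) \<and> (\<forall>x. 0 \<le> u i x)) \<and>
      (\<forall>i\<in>{1..k}. \<forall>j\<in>{1..k}. i \<noteq> j \<longrightarrow> (\<forall>x. u i x * u j x = 0)) \<and>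
      (\<forall>i\<in>{1..k}. weak_subsolution (A i) (u i)) \<and>
      (\<forall>i\<in>{1..k}. \<exists>C>0. \<forall>x. \<bar>u i x\<bar> \<le> C * (1 + norm x powr \<alpha> i)) \<and>
      (\<forall>i\<in>{1..k}. 0 < \<alpha> i) \<and>
      (\<forall>i\<in>{1..k}. \<forall>j\<in>{1..k}. i \<noteq> j \<longrightarrow> \<alpha> i + \<alpha> j < \<nu>)
      \<longrightarrow> (\<exists>S\<subseteq>{1..k}. card S = k - 1 \<and> (\<forall>i\<in>S. \<forall>x. u i x = 0)))"
  proof -
  let ?I = "{1..k}"
  have "elliptic_matrix (A i)" if "i \<in> ?I" for i
    using assms(3) that by unfold_locales auto
  then obtain \<delta> L where \<delta>: "0 < \<delta>" "\<delta> < 1" and L: "2 \<le> L" and decay: "\<And>i. i \<in> ?I \<Longrightarrow> half_zero_decay (A i) \<delta> L"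
    using uniform_decay[of ?I A] by blast
  \<comment> \<open>the second argument is the solution \<open>s\<close> of \<open>(1 - \<delta>) * L powr s = 1\<close>; the minimum with \<open>1\<close> gives \<open>\<nu> < 2\<close>\<close>
  define \<nu> where "\<nu> = min 1 (log L (1 / (1 - \<delta>)))"
  have log_pos: "0 < log L (1 / (1 - \<delta>))" using \<delta> L by (simp add: field_simps)
  have slow: "(1 - \<delta>) * L powr s < 1" if "s < \<nu>" for s
  proof -
    have "L powr s < L powr (log L (1 / (1 - \<delta>)))"
      using that L by (intro powr_less_mono) (auto simp: \<nu>_def)
    also have "\<dots> = 1 / (1 - \<delta>)" using \<delta> L by (intro powr_log_cancel) auto
    finally show ?thesis using \<delta> by (simp add: field_simps)
  qed
  show ?thesis
  proof (intro exI[of _ \<nu>] conjI allI impI)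
    show "0 < \<nu>" "\<nu> < 2" using log_pos by (auto simp: \<nu>_def)
  next
    fix u :: "nat \<Rightarrow> real^'n \<Rightarrow> real" and \<alpha> :: "nat \<Rightarrow> real"
    assume *: "(\<forall>i\<in>{1..k}. H1_loc (u i) \<and> continuous_on UNIV (u i) \<and> (\<forall>x. 0 \<le> u i x)) \<and>
      (\<forall>i\<in>{1..k}. \<forall>j\<in>{1..k}. i \<noteq> j \<longrightarrow> (\<forall>x. u i x * u j x = 0)) \<and>
      (\<forall>i\<in>{1..k}. weak_subsolution (A i) (u i)) \<and>
      (\<forall>i\<in>{1..k}. \<exists>C>0. \<forall>x. \<bar>u i x\<bar> \<le> C * (1 + norm x powr \<alpha> i)) \<and>
      (\<forall>i\<in>{1..k}. 0 < \<alpha> i) \<and>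
      (\<forall>i\<in>{1..k}. \<forall>j\<in>{1..k}. i \<noteq> j \<longrightarrow> \<alpha> i + \<alpha> j < \<nu>)"
    have pair: "(\<forall>x. u i x = 0) \<or> (\<forall>x. u j x = 0)" if ij: "i \<in> ?I" "j \<in> ?I" "i \<noteq> j" for i j
    proof -
      obtain C where C: "0 < C" "\<And>x. \<bar>u i x\<bar> \<le> C * (1 + norm x powr \<alpha> i)" using * ij by blast
      obtain D where D: "0 < D" "\<And>x. \<bar>u j x\<bar> \<le> D * (1 + norm x powr \<alpha> j)" using * ij by blast
      have reg: "continuous_on UNIV (u l)" "weak_subsolution (A l) (u l)" "\<forall>x. 0 \<le> u l x" "0 < \<alpha> l"
        if "l \<in> ?I" for l
        using * that by blast+
      have disj: "u i x * u j x = 0" for x using * ij by blast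
      have "\<alpha> i + \<alpha> j < \<nu>" using * ij by blast
      then have "(1 - \<delta>) * L powr (\<alpha> i + \<alpha> j) < 1" by (rule slow)
      moreover have "u i x \<le> C * (1 + norm x powr \<alpha> i)" "u j x \<le> D * (1 + norm x powr \<alpha> j)" for x
        using C(2)[of x] D(2)[of x] by auto
      moreover have "1 \<le> L" using L by simp
      ultimately show ?thesis
        using slow_growth_imp_zero[OF decay[OF ij(1)] decay[OF ij(2)] \<delta>(2), of "u i" "u j" C "\<alpha> i" D "\<alpha> j"]
          reg[OF ij(1)] reg[OF ij(2)] disj C(1) D(1) by blast
    qed
    show "\<exists>S\<subseteq>?I. card S = k - 1 \<and> (\<forall>i\<in>S. \<forall>x. u i x = 0)"
    proof (cases "\<exists>i\<in>?I. \<exists>x. u i x \<noteq> 0")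
      case True
      then obtain i where i: "i \<in> ?I" "\<exists>x. u i x \<noteq> 0" by blast
      then have "\<forall>j\<in>?I - {i}. \<forall>x. u j x = 0" using pair by blast
      moreover have "card (?I - {i}) = k - 1" using i(1) by simp
      ultimately show ?thesis by (intro exI[of _ "?I - {i}"]) blast
    next
      case False
      moreover have "card (?I - {1}) = k - 1" using assms(1) by simp
      ultimately show ?thesis by (intro exI[of _ "?I - {1}"]) blast
    qed
  qed
qed

end
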